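(* Let $i\in\{1,\dots,M\}$ and $l\in\{1,\dots,r_i\}$, and let $c_j\in\mathbb{R}^{n_j}$ and $\alpha_j\ge0$ for $j\in\{1,\dots,M\}$. Denote by $H^l_i$ the $l$-th row of $H_i$ and by $h^l_i$ the $l$-th element of $h_i$. Suppose there exist scalars $\beta^l_{ij}\ge0$, $j\in\mathcal{N}_i$, such that the symmetric block matrix $$ \begin{bmatrix} \sum_{j\in\mathcal{N}_i}\beta_{ij}^lP_{ij} & \tfrac12\alpha_{\mathcal{N}_i}^{1/2}K_{\mathcal{N}_i}^\top(H_i^l)^\top\\ \tfrac12H_i^lK_{\mathcal{N}_i}\alpha_{\mathcal{N}_i}^{1/2} & h_i^l-H_i^lK_{\mathcal{N}_i}c_{\mathcal{N}_i}-\sum_{j\in\mathcal{N}_i}\beta_{ij}^l \end{bmatrix} $$ is positive semidefinite. Then the $l$-th input constraint $H^l_iK_{\mathcal{N}_i}x_{\mathcal{N}_i}\le h^l_i$ holds for every $x_{\mathcal{N}_i}\in\mathbb{R}^{n_{N_i}}$ whose components $x_j$, $j\in\mathcal{N}_i$, satisfy $(x_j-c_j)^\top P_j(x_j-c_j)\le\alpha_j$ for all $j\in\mathcal{N}_i$.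
   Context: A system is composed of $M$ subsystems; subsystem $j$ has state $x_j\in\mathbb{R}^{n_j}$ and input $u_j\in\mathbb{R}^{m_j}$. The global state is $x=[x_1^\top,\dots,x_M^\top]^\top\in\mathbb{R}^n$. For each $i$, $\mathcal{N}_i\subseteq\{1,\dots,M\}$ is the set of neighbors of subsystem $i$, with $i\in\mathcal{N}_i$, and $x_{\mathcal{N}_i}\in\mathbb{R}^{n_{N_i}}$ is the concatenation of the $x_j$, $j\in\mathcal{N}_i$ (so $n_{N_i}=\sum_{j\in\mathcal{N}_i}n_j$). $U_j\in\{0,1\}^{n_j\times n}$ and $W_{\mathcal{N}_i}\in\{0,1\}^{n_{N_i}\times n}$ are the selection matrices with $x_j=U_jx$ and $x_{\mathcal{N}_i}=W_{\mathcal{N}_i}x$. A terminal controller $u_i=K_{\mathcal{N}_i}x_{\mathcal{N}_i}$ with gain $K_{\mathcal{N}_i}\in\mathbb{R}^{m_i\times n_{N_i}}$ and symmetric positive definite matrices $P_j\in\mathbb{R}^{n_j\times n_j}$ are given; the terminal set of subsystem $j$ is the ellipsoid $\{x_j:(x_j-c_j)^\top P_j(x_j-c_j)\le\alpha_j\}$ with center $c_j$ and size $\alpha_j$. The input constraint set of subsystem $i$ is $\{u_i\in\mathbb{R}^{m_i}:H_iu_i\le h_i\}$ (componentwise inequality) with $H_i\in\mathbb{R}^{r_i\times m_i}$, $h_i\in\mathbb{R}^{r_i}$; it is assumed to contain the origin in its interior. Notation: $\alpha=\operatorname{diag}(\alpha_1I_{n_1},\dots,\alpha_MI_{n_M})$,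 $c=[c_1^\top,\dots,c_M^\top]^\top$, $\alpha_{\mathcal{N}_i}=W_{\mathcal{N}_i}\alpha W_{\mathcal{N}_i}^\top$ (diagonal, with entrywise square root $\alpha_{\mathcal{N}_i}^{1/2}$ on the diagonal), $c_{\mathcal{N}_i}=W_{\mathcal{N}_i}c$. For $j\in\mathcal{N}_i$, $P_{ij}=W_{\mathcal{N}_i}U_j^\top P_jU_jW_{\mathcal{N}_i}^\top$, i.e. the block-diagonal matrix with block $P_j$ at the position of $x_j$ in $x_{\mathcal{N}_i}$ and zeros elsewhere, so that $s_{\mathcal{N}_i}^\top P_{ij}s_{\mathcal{N}_i}=s_j^\top P_js_j$. *)

theory Defs
  imports Complex_Main "Jordan_Normal_Form.Matrix"
begin

text \<open>
  Subsystems are indexed by \<open>0, \<dots>, M - 1\<close>, and rows and entries are 0-based as in the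
  matrix library. Below, \<open>n j\<close> is the state dimension of subsystem \<open>j\<close>.
\<close>

definition pos_semidef_mat :: "real mat \<Rightarrow> bool" where
  "pos_semidef_mat A \<longleftrightarrow> square_mat A \<and> A\<^sup>T = A \<and>
     (\<forall>v \<in> carrier_vec (dim_row A). 0 \<le> v \<bullet> (A *\<^sub>v v))"

definition pos_def_mat :: "real mat \<Rightarrow> bool" where
  "pos_def_mat A \<longleftrightarrow> square_mat A \<and> A\<^sup>T = A \<and>
     (\<forall>v \<in> carrier_vec (dim_row A). v \<noteq> 0\<^sub>v (dim_row A) \<longrightarrow> 0 < v \<bullet> (A *\<^sub>v v))"

definition input_set :: "real mat \<Rightarrow> real vec \<Rightarrow> real vec set" where
  "input_set H h = {u \<in> carrier_vec (dim_col H). H *\<^sub>v u \<le> h}"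

text \<open>The type of vectors of varying dimension carries no topology, so interiority is spelled
  out with Euclidean balls of \<open>\<real>\<^sup>k\<close>.\<close>

definition origin_in_interior :: "nat \<Rightarrow> real vec set \<Rightarrow> bool" where
  "origin_in_interior k S \<longleftrightarrow>
     (\<exists>\<epsilon>>0. {u \<in> carrier_vec k. sqrt (u \<bullet> u) < \<epsilon>} \<subseteq> S)"

definition total_dim :: "(nat \<Rightarrow> nat) \<Rightarrow> nat set \<Rightarrow> nat" where
  "total_dim n J = (\<Sum>j\<in>J. n j)"

text \<open>Concatenation, in increasing order of the index, of the \<open>x j\<close> with \<open>j \<in> J\<close>.\<close>

definition stack_vec :: "nat set \<Rightarrow> (nat \<Rightarrow> real vec) \<Rightarrow> real vec" where
  "stack_vec J x = foldr (@\<^sub>v) (map x (sorted_list_of_set J)) vNil"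

text \<open>The selection matrices \<open>U\<^sub>j\<close> and \<open>W\<^sub>J\<close>; see \<open>sel_mat_stack_vec\<close> and
  \<open>nbr_sel_mat_stack_vec\<close> below.\<close>

definition sel_mat :: "(nat \<Rightarrow> nat) \<Rightarrow> nat \<Rightarrow> nat \<Rightarrow> real mat" where
  "sel_mat n M j = mat (n j) (total_dim n {..<M})
     (\<lambda>(a, b). if b = total_dim n {..<j} + a then 1 else 0)"

definition nbr_sel_mat :: "(nat \<Rightarrow> nat) \<Rightarrow> nat \<Rightarrow> nat set \<Rightarrow> real mat" where
  "nbr_sel_mat n M J =
     foldr (@\<^sub>r) (map (sel_mat n M) (sorted_list_of_set J)) (0\<^sub>m 0 (total_dim n {..<M}))"

definition size_mat :: "(nat \<Rightarrow> nat) \<Rightarrow> nat \<Rightarrow> (nat \<Rightarrow> real) \<Rightarrow> real mat" where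
  "size_mat n M \<alpha> = diag_block_mat (map (\<lambda>j. \<alpha> j \<cdot>\<^sub>m 1\<^sub>m (n j)) [0..<M])"

definition nbr_size_mat :: "(nat \<Rightarrow> nat) \<Rightarrow> nat \<Rightarrow> nat set \<Rightarrow> (nat \<Rightarrow> real) \<Rightarrow> real mat" where
  "nbr_size_mat n M J \<alpha> = nbr_sel_mat n M J * size_mat n M \<alpha> * (nbr_sel_mat n M J)\<^sup>T"

text \<open>The square root is entrywise; it is applied to a diagonal matrix only.\<close>

definition nbr_size_sqrt :: "(nat \<Rightarrow> nat) \<Rightarrow> nat \<Rightarrow> nat set \<Rightarrow> (nat \<Rightarrow> real) \<Rightarrow> real mat" where
  "nbr_size_sqrt n M J \<alpha> = map_mat sqrt (nbr_size_mat n M J \<alpha>)"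

definition nbr_center :: "(nat \<Rightarrow> nat) \<Rightarrow> nat \<Rightarrow> nat set \<Rightarrow> (nat \<Rightarrow> real vec) \<Rightarrow> real vec" where
  "nbr_center n M J c = nbr_sel_mat n M J *\<^sub>v stack_vec {..<M} c"

definition lift_mat ::
  "(nat \<Rightarrow> nat) \<Rightarrow> nat \<Rightarrow> nat set \<Rightarrow> (nat \<Rightarrow> real mat) \<Rightarrow> nat \<Rightarrow> real mat" where
  "lift_mat n M J P j =
     nbr_sel_mat n M J * (sel_mat n M j)\<^sup>T * P j * sel_mat n M j * (nbr_sel_mat n M J)\<^sup>T"

text \<open>The matrix of the linear matrix inequality, for a neighbor set \<open>J\<close>, a gain \<open>K\<close>, a row
  \<open>Hl\<close> of the input constraint matrix and the corresponding right-hand side \<open>hl\<close>.\<close>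

definition input_lmi_mat ::
  "(nat \<Rightarrow> nat) \<Rightarrow> nat \<Rightarrow> nat set \<Rightarrow> (nat \<Rightarrow> real mat) \<Rightarrow> real mat \<Rightarrow> real vec \<Rightarrow> real \<Rightarrow>
   (nat \<Rightarrow> real vec) \<Rightarrow> (nat \<Rightarrow> real) \<Rightarrow> (nat \<Rightarrow> real) \<Rightarrow> real mat" where
  "input_lmi_mat n M J P K Hl hl c \<alpha> \<beta> =
     four_block_mat
       (\<Oplus>\<^bsub>ring_mat TYPE(real) (total_dim n J) ()\<^esub>j\<in>J. \<beta> j \<cdot>\<^sub>m lift_mat n M J P j)
       ((1/2) \<cdot>\<^sub>m (nbr_size_sqrt n M J \<alpha> * K\<^sup>T * (mat_of_row Hl)\<^sup>T))
       ((1/2) \<cdot>\<^sub>m (mat_of_row Hl * K * nbr_size_sqrt n M J \<alpha>))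
       (mat 1 1 (\<lambda>_. hl - Hl \<bullet> (K *\<^sub>v nbr_center n M J c) - (\<Sum>j\<in>J. \<beta> j)))"


text \<open>Consistency of the encoding.\<close>

lemma stack_list_carrier:
  assumes "\<forall>j\<in>set js. x j \<in> carrier_vec (n j)"
  shows "foldr (@\<^sub>v) (map x js) vNil \<in> carrier_vec (\<Sum>j\<leftarrow>js. n j)"
  using assms
proof (induction js)
  case Nil
  show ?case by (rule carrier_vecI) simp
next
  case (Cons j js)
  then have "x j @\<^sub>v foldr (@\<^sub>v) (map x js) vNil \<in> carrier_vec (n j + (\<Sum>j\<leftarrow>js. n j))"
    by (intro append_carrier_vec) simp_all
  then show ?case by simp
qed

lemma stack_vec_carrier:
  assumes "finite J" and "\<forall>j\<in>J. x j \<in> carrier_vec (n j)"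
  shows "stack_vec J x \<in> carrier_vec (total_dim n J)"
  using stack_list_carrier[of "sorted_list_of_set J" x n] assms
  by (simp add: stack_vec_def total_dim_def sum_list_distinct_conv_sum_set)

lemma stack_list_surj:
  fixes y :: "real vec" and n :: "nat \<Rightarrow> nat"
  assumes "y \<in> carrier_vec (\<Sum>j\<leftarrow>js. n j)" and "distinct js"
  shows "\<exists>x. (\<forall>j. x j \<in> carrier_vec (n j)) \<and> y = foldr (@\<^sub>v) (map x js) vNil"
  using assms
proof (induction js arbitrary: y)
  case Nil
  then have "y = vNil" by (auto intro: eq_vecI)
  then show ?case by (intro exI[of _ "\<lambda>j. 0\<^sub>v (n j)"]) simp
next
  case (Cons k js)
  let ?m = "\<Sum>j\<leftarrow>js. n j"
  have y: "y = vec_first y (n k) @\<^sub>v vec_last y ?m"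
    using Cons.prems(1) by (simp add: vec_first_last_append)
  obtain x where x: "\<forall>j. x j \<in> carrier_vec (n j)"
      "vec_last y ?m = foldr (@\<^sub>v) (map x js) vNil"
    using Cons.IH[of "vec_last y ?m"] Cons.prems(2) by auto
  let ?x = "x(k := vec_first y (n k))"
  have "map ?x (k # js) = vec_first y (n k) # map x js"
    using Cons.prems(2) by auto
  then have "y = foldr (@\<^sub>v) (map ?x (k # js)) vNil"
    using x(2) y by (simp only: foldr.simps o_apply)
  moreover have "\<forall>j. ?x j \<in> carrier_vec (n j)" using x(1) by simp
  ultimately show ?case by blast
qed

lemma stack_vec_surj:
  assumes "finite J" and "y \<in> carrier_vec (total_dim n J)"
  shows "\<exists>x. (\<forall>j\<in>J. x j \<in> carrier_vec (n j)) \<and> y = stack_vec J x"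
  using stack_list_surj[of y n "sorted_list_of_set J"] assms
  by (auto simp: stack_vec_def total_dim_def sum_list_distinct_conv_sum_set)

lemma append_vec_assoc': "(u @\<^sub>v v) @\<^sub>v w = u @\<^sub>v (v @\<^sub>v w)"
proof (rule eq_vecI)
  fix k assume k: "k < dim_vec (u @\<^sub>v (v @\<^sub>v w))"
  consider "k < dim_vec u" | "\<not> k < dim_vec u" "k < dim_vec u + dim_vec v"
    | "\<not> k < dim_vec u + dim_vec v" "k < dim_vec u + (dim_vec v + dim_vec w)"
    using k by fastforce
  then show "((u @\<^sub>v v) @\<^sub>v w) $ k = (u @\<^sub>v (v @\<^sub>v w)) $ k"
  proof cases
    case 2
    then have "k - dim_vec u < dim_vec v" by linarith
    with 2 show ?thesis by simp
  next
    case 3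
    then have "\<not> k < dim_vec u" "\<not> k - dim_vec u < dim_vec v"
      "k - dim_vec u < dim_vec v + dim_vec w" by linarith+
    with 3 show ?thesis by simp
  qed simp
qed simp

lemma stack_list_index:
  assumes "\<forall>j<M. x j \<in> carrier_vec (n j)" and "j < M" and "a < n j"
  shows "foldr (@\<^sub>v) (map x [0..<M]) vNil $ (total_dim n {..<j} + a) = x j $ a"
proof -
  let ?f = "\<lambda>js. foldr (@\<^sub>v) (map x js) vNil"
  have split: "?f (js @ ks) = ?f js @\<^sub>v ?f ks" for js ks
    by (induction js) (simp_all add: append_vec_assoc')
  have eq: "[0..<M] = [0..<j] @ j # [Suc j..<M]"
    using upt_add_eq_append[of 0 j "M - j"] upt_conv_Cons[of j M] assms(2) by simp
  have dim: "dim_vec (?f [0..<j]) = total_dim n {..<j}"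
    using stack_list_carrier[of "[0..<j]" x n] assms(1,2)
    by (simp add: total_dim_def interv_sum_list_conv_sum_set_nat lessThan_atLeast0)
  have "dim_vec (x j) = n j" using assms by auto
  then show ?thesis unfolding eq split using dim assms(3) by simp
qed

lemma total_dim_block:
  assumes "j < M" and "a < n j"
  shows "total_dim n {..<j} + a < total_dim n {..<M}"
proof -
  have "total_dim n {..<j} + a < total_dim n {..<Suc j}"
    using assms by (simp add: total_dim_def)
  also have "\<dots> \<le> total_dim n {..<M}"
    unfolding total_dim_def using assms by (intro sum_mono2) auto
  finally show ?thesis .
qed

lemma sel_mat_stack_vec:
  assumes "\<forall>j<M. x j \<in> carrier_vec (n j)" and "j < M"
  shows "sel_mat n M j *\<^sub>v stack_vec {..<M} x = x j"
proof -
  have s: "stack_vec {..<M} x = foldr (@\<^sub>v) (map x [0..<M]) vNil"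
    unfolding stack_vec_def by (simp add: lessThan_atLeast0)
  have d: "dim_vec (stack_vec {..<M} x) = total_dim n {..<M}"
    using stack_vec_carrier[of "{..<M}" x n] assms(1) by auto
  show ?thesis
  proof (rule eq_vecI)
    show "dim_vec (sel_mat n M j *\<^sub>v stack_vec {..<M} x) = dim_vec (x j)"
      using assms by (auto simp: sel_mat_def)
    fix a assume "a < dim_vec (x j)"
    then have a: "a < n j" using assms by auto
    have "(sel_mat n M j *\<^sub>v stack_vec {..<M} x) $ a =
      (\<Sum>b<total_dim n {..<M}. (if b = total_dim n {..<j} + a then 1 else 0) *
         stack_vec {..<M} x $ b)"
      using a d by (simp add: sel_mat_def scalar_prod_def lessThan_atLeast0)
    also have "\<dots> = stack_vec {..<M} x $ (total_dim n {..<j} + a)"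
      using total_dim_block[of j M a n] assms(2) a
      by (simp add: if_distrib[of "\<lambda>c. c * _"] cong: if_cong)
    also have "\<dots> = x j $ a"
      unfolding s using stack_list_index assms a by blast
    finally show "(sel_mat n M j *\<^sub>v stack_vec {..<M} x) $ a = x j $ a" .
  qed
qed

lemma sel_list_carrier:
  "foldr (@\<^sub>r) (map (sel_mat n M) js) (0\<^sub>m 0 (total_dim n {..<M}))
    \<in> carrier_mat (\<Sum>j\<leftarrow>js. n j) (total_dim n {..<M})"
  by (induction js) (auto intro!: carrier_append_rows simp: sel_mat_def)

lemma nbr_sel_mat_carrier:
  assumes "finite J"
  shows "nbr_sel_mat n M J \<in> carrier_mat (total_dim n J) (total_dim n {..<M})"
  using sel_list_carrier[of n M "sorted_list_of_set J"] assms
  by (simp add: nbr_sel_mat_def total_dim_def sum_list_distinct_conv_sum_set)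

lemma nbr_sel_mat_stack_vec:
  assumes "\<forall>j<M. x j \<in> carrier_vec (n j)" and "J \<subseteq> {..<M}"
  shows "nbr_sel_mat n M J *\<^sub>v stack_vec {..<M} x = stack_vec J x"
proof -
  let ?N = "total_dim n {..<M}"
  have X: "stack_vec {..<M} x \<in> carrier_vec ?N"
    using stack_vec_carrier[of "{..<M}" x n] assms(1) by auto
  have "foldr (@\<^sub>r) (map (sel_mat n M) js) (0\<^sub>m 0 ?N) *\<^sub>v stack_vec {..<M} x =
      foldr (@\<^sub>v) (map x js) vNil" if "set js \<subseteq> {..<M}" for js
    using that
  proof (induction js)
    case Nil
    then show ?case by (auto intro: eq_vecI)
  next
    case (Cons j js)
    have "sel_mat n M j \<in> carrier_mat (n j) ?N" by (simp add: sel_mat_def)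
    from mat_mult_append[OF this sel_list_carrier X] Cons show ?case
      using sel_mat_stack_vec[of M x n j] assms(1) by simp
  qed
  moreover have "finite J" using assms(2) finite_subset by blast
  ultimately show ?thesis
    unfolding nbr_sel_mat_def stack_vec_def[of J] using assms(2) by simp
qed

end

theory Submission
  imports Defs
begin

text \<open>
  Put \<open>x\<^sub>j = c\<^sub>j + \<alpha>\<^sub>j\<^sup>1\<^sup>/\<^sup>2 s\<^sub>j\<close>; membership of \<open>x\<^sub>j\<close> in the ellipsoid becomes
  \<open>s\<^sub>j \<bullet> P\<^sub>j s\<^sub>j \<le> 1\<close> (when \<open>\<alpha>\<^sub>j = 0\<close>, definiteness forces \<open>x\<^sub>j = c\<^sub>j\<close> and \<open>s\<^sub>j = 0\<close> works).
  Evaluating the quadratic form of the matrix inequality at \<open>(s, -1)\<close> gives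
  \<open>h - H K x \<ge> \<Sum>\<^sub>j \<beta>\<^sub>j (1 - s\<^sub>j \<bullet> P\<^sub>j s\<^sub>j) \<ge> 0\<close>, which is the easy direction of the S-procedure.
\<close>

section \<open>Transposed row stacks and scalar multiples acting on vectors\<close>

lemma transpose_append_rows_mult_vec:
  fixes A B :: "real mat"
  assumes A: "A \<in> carrier_mat a d" and B: "B \<in> carrier_mat b d"
    and u: "u \<in> carrier_vec a" and v: "v \<in> carrier_vec b"
  shows "(A @\<^sub>r B)\<^sup>T *\<^sub>v (u @\<^sub>v v) = A\<^sup>T *\<^sub>v u + B\<^sup>T *\<^sub>v v"
proof -
  \<comment> \<open>\<open>append_rows\<close> is a block matrix whose right blocks have no columns.
    Transposed, they become lower blocks without rows, so the rule for block products applies and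
    its lower part is the empty vector.\<close>
  have T: "(A @\<^sub>r B)\<^sup>T = four_block_mat (A\<^sup>T) (B\<^sup>T) (0\<^sub>m 0 a) (0\<^sub>m 0 b)"
    unfolding append_rows_def using A B
    by (subst transpose_four_block_mat[of _ a d _ 0 _ b]) auto
  have "(A @\<^sub>r B)\<^sup>T *\<^sub>v (u @\<^sub>v v) =
      (A\<^sup>T *\<^sub>v u + B\<^sup>T *\<^sub>v v) @\<^sub>v (0\<^sub>m 0 a *\<^sub>v u + 0\<^sub>m 0 b *\<^sub>v v)"
    unfolding T using A B u v by (intro four_block_mat_mult_vec) auto
  also have "\<dots> = A\<^sup>T *\<^sub>v u + B\<^sup>T *\<^sub>v v"
    using A B by (intro eq_vecI) auto
  finally show ?thesis .
qed

lemma smult_mat_mult_vec: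
  fixes A :: "real mat"
  assumes "A \<in> carrier_mat a d" and "v \<in> carrier_vec d"
  shows "(k \<cdot>\<^sub>m A) *\<^sub>v v = k \<cdot>\<^sub>v (A *\<^sub>v v)"
  using assms by (intro eq_vecI) auto

section \<open>Selection matrices and their transposes on stacked vectors\<close>

lemma sel_mat_carrier: "sel_mat n M j \<in> carrier_mat (n j) (total_dim n {..<M})"
  by (simp add: sel_mat_def)

lemma row_sel_mat:
  assumes "j < M" and "a < n j"
  shows "row (sel_mat n M j) a = unit_vec (total_dim n {..<M}) (total_dim n {..<j} + a)"
  using assms by (intro eq_vecI) (auto simp: sel_mat_def unit_vec_def)

text \<open>Distinct blocks occupy disjoint index ranges: \<open>total_dim_block\<close>, with the
  later block's index in place of \<open>M\<close>, puts every position of the earlier block before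
  the start of the later one.\<close>

lemma block_offset_inj:
  assumes "a < n j" and "b < n k" and "j \<noteq> k"
  shows "total_dim n {..<j} + a \<noteq> total_dim n {..<k} + b"
proof -
  have *: "total_dim n {..<p} + c < total_dim n {..<q} + d" if "c < n p" "p < q" for p q c d
    using total_dim_block[of p q c n] that by linarith
  show ?thesis
    using *[of a j k b] *[of b k j a] assms by (cases "j < k") auto
qed

text \<open>The rows of all selection matrices are unit vectors at pairwise different positions,
  hence orthonormal. So the product of one selection matrix with the transpose of another is an
  identity or zero.\<close>

lemma sel_mat_mult_transpose:
  assumes "j < M" and "k < M" and "v \<in> carrier_vec (n j)"
  shows "sel_mat n M k *\<^sub>v ((sel_mat n M j)\<^sup>T *\<^sub>v v) = (if k = j then v else 0\<^sub>v (n k))"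
proof -
  let ?N = "total_dim n {..<M}"
  have "sel_mat n M k * (sel_mat n M j)\<^sup>T = (if k = j then 1\<^sub>m (n k) else 0\<^sub>m (n k) (n j))"
  proof (rule eq_matI)
    fix a b
    assume "a < dim_row (if k = j then 1\<^sub>m (n k) else 0\<^sub>m (n k) (n j) :: real mat)"
      and "b < dim_col (if k = j then 1\<^sub>m (n k) else 0\<^sub>m (n k) (n j) :: real mat)"
    then have ab: "a < n k" "b < n j" by (auto split: if_splits)
    have "(sel_mat n M k * (sel_mat n M j)\<^sup>T) $$ (a, b) =
        row (sel_mat n M k) a \<bullet> row (sel_mat n M j) b"
      using ab by (simp add: sel_mat_def)
    also have "\<dots> = unit_vec ?N (total_dim n {..<k} + a) $ (total_dim n {..<j} + b)"
      using assms(1,2) ab total_dim_block[of j M b n] by (simp add: row_sel_mat)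
    also have "\<dots> = (if k = j then 1\<^sub>m (n k) else 0\<^sub>m (n k) (n j)) $$ (a, b)"
      using total_dim_block[of j M b n] total_dim_block[of k M a n]
        block_offset_inj[of a n k b j] assms(1,2) ab by auto
    finally show "(sel_mat n M k * (sel_mat n M j)\<^sup>T) $$ (a, b) =
        (if k = j then 1\<^sub>m (n k) else 0\<^sub>m (n k) (n j)) $$ (a, b)" .
  qed (auto simp: sel_mat_def)
  moreover have "sel_mat n M k *\<^sub>v ((sel_mat n M j)\<^sup>T *\<^sub>v v) =
      (sel_mat n M k * (sel_mat n M j)\<^sup>T) *\<^sub>v v"
    using sel_mat_carrier[of n M k] sel_mat_carrier[of n M j] assms(3)
    by (intro assoc_mult_mat_vec[symmetric]) auto
  ultimately show ?thesis using assms(3) by auto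
qed

text \<open>The transposed neighbor selection is a sum of the embeddings
  \<open>(sel_mat n M j)\<^sup>T\<close> of the single blocks, and by orthogonality
  \<open>sel_mat n M k\<close> annihilates all of them except the one with
  \<open>j = k\<close>.\<close>

lemma sel_mat_nbr_sel_transpose:
  assumes "J \<subseteq> {..<M}" and "k < M" and s: "\<And>j. s j \<in> carrier_vec (n j)"
  shows "sel_mat n M k *\<^sub>v ((nbr_sel_mat n M J)\<^sup>T *\<^sub>v stack_vec J s) =
    (if k \<in> J then s k else 0\<^sub>v (n k))"
proof -
  let ?N = "total_dim n {..<M}"
  let ?W = "\<lambda>js. foldr (@\<^sub>r) (map (sel_mat n M) js) (0\<^sub>m 0 ?N)"
  let ?f = "\<lambda>js. foldr (@\<^sub>v) (map s js) vNil"
  have "sel_mat n M k *\<^sub>v ((?W js)\<^sup>T *\<^sub>v ?f js) = (if k \<in> set js then s k else 0\<^sub>v (n k))"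
    if "set js \<subseteq> {..<M}" "distinct js" for js
    using that
  proof (induction js)
    case Nil
    have "(0\<^sub>m 0 ?N)\<^sup>T *\<^sub>v vNil = (0\<^sub>v ?N :: real vec)" by (intro eq_vecI) auto
    then show ?case using sel_mat_carrier[of n M k] by auto
  next
    case (Cons j js)
    have W: "?W js \<in> carrier_mat (\<Sum>j\<leftarrow>js. n j) ?N" by (rule sel_list_carrier)
    have f: "?f js \<in> carrier_vec (\<Sum>j\<leftarrow>js. n j)" using s by (intro stack_list_carrier) simp
    have "sel_mat n M k *\<^sub>v ((?W (j # js))\<^sup>T *\<^sub>v ?f (j # js)) =
        sel_mat n M k *\<^sub>v ((sel_mat n M j)\<^sup>T *\<^sub>v s j + (?W js)\<^sup>T *\<^sub>v ?f js)"
      using transpose_append_rows_mult_vec[OF sel_mat_carrier W s f] by simp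
    also have "\<dots> = sel_mat n M k *\<^sub>v ((sel_mat n M j)\<^sup>T *\<^sub>v s j) +
        sel_mat n M k *\<^sub>v ((?W js)\<^sup>T *\<^sub>v ?f js)"
      using W f s sel_mat_carrier[of n M j]
      by (intro mult_add_distrib_mat_vec[OF sel_mat_carrier] mult_mat_vec_carrier) auto
    \<comment> \<open>Distinctness of the list matters here: if \<open>k = j\<close>, then
      \<open>k\<close> does not occur in \<open>js\<close>, so the second summand vanishes and
      \<open>s k\<close> is counted once.\<close>
    also have "\<dots> = (if k \<in> set (j # js) then s k else 0\<^sub>v (n k))"
      using Cons sel_mat_mult_transpose[of j M k "s j" n] assms(2) s by auto
    finally show ?case .
  qed
  moreover have "finite J" using assms(1) finite_subset by blast
  ultimately show ?thesis
    unfolding nbr_sel_mat_def stack_vec_def using assms(1) by simp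
qed

lemma stack_vec_cong:
  assumes "finite J" and "\<And>j. j \<in> J \<Longrightarrow> x j = y j"
  shows "stack_vec J x = stack_vec J y"
proof -
  have "map x (sorted_list_of_set J) = map y (sorted_list_of_set J)" using assms by simp
  then show ?thesis by (simp only: stack_vec_def)
qed

lemma nbr_sel_transpose_stack_vec:
  assumes "J \<subseteq> {..<M}" and s: "\<And>j. s j \<in> carrier_vec (n j)"
  shows "(nbr_sel_mat n M J)\<^sup>T *\<^sub>v stack_vec J s =
    stack_vec {..<M} (\<lambda>j. if j \<in> J then s j else 0\<^sub>v (n j))"
proof -
  have J: "finite J" using assms(1) finite_subset by blast
  define y where "y = (nbr_sel_mat n M J)\<^sup>T *\<^sub>v stack_vec J s"
  have "y \<in> carrier_vec (total_dim n {..<M})"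
    unfolding y_def using nbr_sel_mat_carrier[OF J, of n M] stack_vec_carrier[OF J, of s n] s
    by (intro mult_mat_vec_carrier) auto
  \<comment> \<open>Every global vector is a stack of blocks, so it suffices to identify the blocks
    \<open>z k\<close>, and \<open>sel_mat n M k\<close> reads them off one at a time.\<close>
  from stack_vec_surj[OF _ this] obtain z
    where z: "\<forall>j<M. z j \<in> carrier_vec (n j)" "y = stack_vec {..<M} z" by auto
  have "z k = (if k \<in> J then s k else 0\<^sub>v (n k))" if "k < M" for k
    using sel_mat_stack_vec[of M z n k] z that
      sel_mat_nbr_sel_transpose[of J M k s n, OF assms(1) that s] y_def by auto
  then have "stack_vec {..<M} z = stack_vec {..<M} (\<lambda>j. if j \<in> J then s j else 0\<^sub>v (n j))"
    by (intro stack_vec_cong) auto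
  then show ?thesis using z(2) y_def by simp
qed

section \<open>The size matrix, its entrywise root and its action on stacked vectors\<close>

lemma size_mat_carrier: "size_mat n M \<alpha> \<in> carrier_mat (total_dim n {..<M}) (total_dim n {..<M})"
  by (auto simp: size_mat_def dim_diag_block_mat total_dim_def interv_sum_list_conv_sum_set_nat
      lessThan_atLeast0 o_def)

lemma size_mat_stack_vec:
  assumes x: "\<forall>j<M. x j \<in> carrier_vec (n j)"
  shows "size_mat n M \<alpha> *\<^sub>v stack_vec {..<M} x = stack_vec {..<M} (\<lambda>j. \<alpha> j \<cdot>\<^sub>v x j)"
proof -
  let ?D = "\<lambda>js. diag_block_mat (map (\<lambda>j. \<alpha> j \<cdot>\<^sub>m 1\<^sub>m (n j)) js)"
  let ?f = "\<lambda>x js. foldr (@\<^sub>v) (map x js) vNil"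
  have "?D js *\<^sub>v ?f x js = ?f (\<lambda>j. \<alpha> j \<cdot>\<^sub>v x j) js" if "set js \<subseteq> {..<M}" for js
    using that
  proof (induction js)
    case Nil
    show ?case by (auto intro: eq_vecI)
  next
    case (Cons j js)
    let ?m = "\<Sum>j\<leftarrow>js. n j"
    have D: "?D js \<in> carrier_mat ?m ?m" by (auto simp: dim_diag_block_mat o_def)
    have f: "?f x js \<in> carrier_vec ?m"
      using x Cons.prems by (intro stack_list_carrier) auto
    have xj: "x j \<in> carrier_vec (n j)" using x Cons.prems by auto
    have "?D (j # js) *\<^sub>v ?f x (j # js) =
        ((\<alpha> j \<cdot>\<^sub>m 1\<^sub>m (n j)) *\<^sub>v x j) @\<^sub>v (?D js *\<^sub>v ?f x js)"
      using mult_mat_vec_split[of "\<alpha> j \<cdot>\<^sub>m 1\<^sub>m (n j)" "n j", OF _ D xj f] D by (simp add: Let_def)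
    also have "(\<alpha> j \<cdot>\<^sub>m 1\<^sub>m (n j)) *\<^sub>v x j = \<alpha> j \<cdot>\<^sub>v x j"
      using xj by (intro eq_vecI) auto
    finally show ?case using Cons by simp
  qed
  then show ?thesis unfolding size_mat_def stack_vec_def by (simp add: lessThan_atLeast0)
qed

text \<open>Since \<open>sqrt 0 = 0\<close>, the zeros off the diagonal survive the entrywise root,
  and only the diagonal entries change.\<close>

lemma sqrt_size_mat: "map_mat sqrt (size_mat n M \<alpha>) = size_mat n M (\<lambda>j. sqrt (\<alpha> j))"
proof -
  let ?D = "\<lambda>\<alpha> js. diag_block_mat (map (\<lambda>j. \<alpha> j \<cdot>\<^sub>m 1\<^sub>m (n j)) js) :: real mat"
  have "map_mat sqrt (?D \<alpha> js) = ?D (\<lambda>j. sqrt (\<alpha> j)) js" for js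
  proof (induction js)
    case Nil
    show ?case by (auto intro: eq_matI)
  next
    case (Cons j js)
    have "dim_row (?D \<alpha> js) = dim_row (?D (\<lambda>j. sqrt (\<alpha> j)) js)"
      "dim_col (?D \<alpha> js) = dim_col (?D (\<lambda>j. sqrt (\<alpha> j)) js)"
      by (simp_all add: dim_diag_block_mat o_def)
    then show ?case
      by (auto simp: Let_def Cons.IH[symmetric] intro!: eq_matI)
  qed
  then show ?thesis by (simp add: size_mat_def)
qed

text \<open>Each row comes from one of the stacked \<open>sel_mat\<close> blocks, whose rows are
  unit vectors. The bound on \<open>b\<close> is recorded because reading an entry through a unit
  vector requires an index in range.\<close>

lemma row_nbr_sel_mat:
  assumes "J \<subseteq> {..<M}" and "p < total_dim n J"
  shows "\<exists>b<total_dim n {..<M}. row (nbr_sel_mat n M J) p = unit_vec (total_dim n {..<M}) b"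
proof -
  let ?N = "total_dim n {..<M}"
  let ?W = "\<lambda>js. foldr (@\<^sub>r) (map (sel_mat n M) js) (0\<^sub>m 0 ?N)"
  have "\<exists>b<?N. row (?W js) p = unit_vec ?N b"
    if "set js \<subseteq> {..<M}" "p < (\<Sum>j\<leftarrow>js. n j)" for js p
    using that
  proof (induction js arbitrary: p)
    case Nil
    then show ?case by simp
  next
    case (Cons j js)
    have j: "j < M" using Cons.prems by simp
    have W: "?W js \<in> carrier_mat (\<Sum>j\<leftarrow>js. n j) ?N" by (rule sel_list_carrier)
    have dims: "dim_row (sel_mat n M j) = n j" "dim_col (sel_mat n M j) = ?N"
      by (simp_all add: sel_mat_def)
    have rows: "row (?W (j # js)) p =
        (if p < n j then row (sel_mat n M j) p else row (?W js) (p - n j))"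
      using W dims Cons.prems(2) by (intro eq_vecI) (auto simp: append_rows_def)
    show ?case
    proof (cases "p < n j")
      case True
      then show ?thesis
        using rows row_sel_mat[of j M p n] total_dim_block[of j M p n] j by auto
    next
      case False
      then show ?thesis using rows Cons.IH[of "p - n j"] Cons.prems by auto
    qed
  qed
  moreover have "finite J" using assms(1) finite_subset by blast
  ultimately show ?thesis using assms
    by (simp add: nbr_sel_mat_def total_dim_def sum_list_distinct_conv_sum_set)
qed

text \<open>Each row of the selection matrix is a unit vector, so the entries of \<open>W \<alpha> W\<^sup>T\<close> are entries
  of \<open>\<alpha>\<close>, and the entrywise root commutes with the selection.\<close>

lemma nbr_size_sqrt_eq:
  assumes "J \<subseteq> {..<M}"
  shows "nbr_size_sqrt n M J \<alpha> = nbr_size_mat n M J (\<lambda>j. sqrt (\<alpha> j))"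
proof -
  let ?N = "total_dim n {..<M}" and ?d = "total_dim n J"
  let ?W = "nbr_sel_mat n M J"
  have J: "finite J" using assms finite_subset by blast
  note W = nbr_sel_mat_carrier[OF J, of n M]
  note S = size_mat_carrier[of n M]
  \<comment> \<open>\<open>\<phi>\<close> maps a coordinate of the neighbor vector to its position
    in the global vector.\<close>
  obtain \<phi> where \<phi>: "\<And>p. p < ?d \<Longrightarrow> \<phi> p < ?N \<and> row ?W p = unit_vec ?N (\<phi> p)"
    using row_nbr_sel_mat[OF assms, of _ n] by metis
  \<comment> \<open>Stated for arbitrary sizes \<open>\<gamma>\<close>, since it is applied both to
    \<open>\<alpha>\<close> and to the square roots of \<open>\<alpha>\<close>.\<close>
  have entry: "nbr_size_mat n M J \<gamma> $$ (p, q) = size_mat n M \<gamma> $$ (\<phi> p, \<phi> q)"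
    if pq: "p < ?d" "q < ?d" for \<gamma> p q
  proof -
    have "nbr_size_mat n M J \<gamma> $$ (p, q) = (?W * (size_mat n M \<gamma> * ?W\<^sup>T)) $$ (p, q)"
      unfolding nbr_size_mat_def using W S[of \<gamma>] by (subst assoc_mult_mat) auto
    also have "\<dots> = row ?W p \<bullet> col (size_mat n M \<gamma> * ?W\<^sup>T) q"
      using W S[of \<gamma>] pq by simp
    also have "\<dots> = (size_mat n M \<gamma> * ?W\<^sup>T) $$ (\<phi> p, q)"
      using W S[of \<gamma>] pq \<phi>[of p] by simp
    also have "\<dots> = row (size_mat n M \<gamma>) (\<phi> p) \<bullet> row ?W q"
      using W S[of \<gamma>] pq \<phi>[of p] by simp
    also have "\<dots> = size_mat n M \<gamma> $$ (\<phi> p, \<phi> q)"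
      using W S[of \<gamma>] pq \<phi>[of p] \<phi>[of q] by simp
    finally show ?thesis .
  qed
  show ?thesis
  proof (rule eq_matI)
    fix p q assume "p < dim_row (nbr_size_mat n M J (\<lambda>j. sqrt (\<alpha> j)))"
      and "q < dim_col (nbr_size_mat n M J (\<lambda>j. sqrt (\<alpha> j)))"
    then have pq: "p < ?d" "q < ?d" using W by (auto simp: nbr_size_mat_def)
    have "nbr_size_sqrt n M J \<alpha> $$ (p, q) = sqrt (nbr_size_mat n M J \<alpha> $$ (p, q))"
      unfolding nbr_size_sqrt_def using pq W by (simp add: nbr_size_mat_def)
    also have "\<dots> = map_mat sqrt (size_mat n M \<alpha>) $$ (\<phi> p, \<phi> q)"
      using entry[OF pq] \<phi> pq S[of \<alpha>] by simp
    finally show "nbr_size_sqrt n M J \<alpha> $$ (p, q) =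
        nbr_size_mat n M J (\<lambda>j. sqrt (\<alpha> j)) $$ (p, q)"
      unfolding sqrt_size_mat using entry[OF pq] by simp
  qed (auto simp: nbr_size_sqrt_def nbr_size_mat_def)
qed

lemma nbr_size_mat_carrier:
  assumes "finite J"
  shows "nbr_size_mat n M J \<alpha> \<in> carrier_mat (total_dim n J) (total_dim n J)"
  using nbr_sel_mat_carrier[OF assms, of n M] by (auto simp: nbr_size_mat_def)

lemma stack_vec_add:
  assumes J: "finite J" and x: "\<And>j. j \<in> J \<Longrightarrow> x j \<in> carrier_vec (n j)"
    and y: "\<And>j. j \<in> J \<Longrightarrow> y j \<in> carrier_vec (n j)"
  shows "stack_vec J (\<lambda>j. x j + y j) = stack_vec J x + (stack_vec J y :: real vec)"
proof -
  let ?f = "\<lambda>x js. foldr (@\<^sub>v) (map x js) vNil :: real vec"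
  have "?f (\<lambda>j. x j + y j) js = ?f x js + ?f y js" if "set js \<subseteq> J" for js
    using that
  proof (induction js)
    case Nil
    show ?case by (auto intro: eq_vecI)
  next
    case (Cons j js)
    have "?f x js \<in> carrier_vec (\<Sum>j\<leftarrow>js. n j)" "?f y js \<in> carrier_vec (\<Sum>j\<leftarrow>js. n j)"
      using Cons.prems x y by (auto intro!: stack_list_carrier)
    moreover have "x j \<in> carrier_vec (n j)" "y j \<in> carrier_vec (n j)"
      using Cons.prems x y by auto
    ultimately show ?case using Cons by (simp add: append_vec_add)
  qed
  then show ?thesis using J by (simp add: stack_vec_def)
qed

text \<open>The three factors act in turn: the transposed selection pads the neighbor blocks with
  zero blocks, the size matrix scales every block, and the selection drops the padding
  again.\<close>

lemma nbr_size_mat_stack_vec: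
  assumes "J \<subseteq> {..<M}" and s: "\<And>j. s j \<in> carrier_vec (n j)"
  shows "nbr_size_mat n M J \<alpha> *\<^sub>v stack_vec J s = stack_vec J (\<lambda>j. \<alpha> j \<cdot>\<^sub>v s j)"
proof -
  let ?W = "nbr_sel_mat n M J"
  let ?t = "\<lambda>j. if j \<in> J then s j else 0\<^sub>v (n j)"
  have J: "finite J" using assms(1) finite_subset by blast
  note W = nbr_sel_mat_carrier[OF J, of n M] and S = size_mat_carrier[of n M \<alpha>]
  have y: "stack_vec J s \<in> carrier_vec (total_dim n J)"
    using s by (intro stack_vec_carrier[OF J]) auto
  have "nbr_size_mat n M J \<alpha> *\<^sub>v stack_vec J s =
      ?W *\<^sub>v (size_mat n M \<alpha> *\<^sub>v (?W\<^sup>T *\<^sub>v stack_vec J s))"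
  proof -
    have "nbr_size_mat n M J \<alpha> *\<^sub>v stack_vec J s =
        (?W * size_mat n M \<alpha>) *\<^sub>v (?W\<^sup>T *\<^sub>v stack_vec J s)"
      unfolding nbr_size_mat_def using W S y
      by (intro assoc_mult_mat_vec[of _ "total_dim n J" "total_dim n {..<M}"]) auto
    also have "\<dots> = ?W *\<^sub>v (size_mat n M \<alpha> *\<^sub>v (?W\<^sup>T *\<^sub>v stack_vec J s))"
      using W S y by (intro assoc_mult_mat_vec mult_mat_vec_carrier) auto
    finally show ?thesis .
  qed
  also have "\<dots> = ?W *\<^sub>v stack_vec {..<M} (\<lambda>j. \<alpha> j \<cdot>\<^sub>v ?t j)"
    unfolding nbr_sel_transpose_stack_vec[of J M s n, OF assms]
    using s by (subst size_mat_stack_vec) auto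
  also have "\<dots> = stack_vec J (\<lambda>j. \<alpha> j \<cdot>\<^sub>v ?t j)"
    using s assms(1) by (intro nbr_sel_mat_stack_vec) auto
  also have "\<dots> = stack_vec J (\<lambda>j. \<alpha> j \<cdot>\<^sub>v s j)"
    using J by (intro stack_vec_cong) auto
  finally show ?thesis .
qed

section \<open>Quadratic forms of lifted, summed and bordered matrices\<close>

lemma lift_mat_carrier:
  assumes "finite J"
  shows "lift_mat n M J P j \<in> carrier_mat (total_dim n J) (total_dim n J)"
  using nbr_sel_mat_carrier[OF assms, of n M] by (auto simp: lift_mat_def)

text \<open>With \<open>A = sel_mat n M j * (nbr_sel_mat n M J)\<^sup>T\<close>, the lifted matrix
  is the congruence \<open>A\<^sup>T * P j * A\<close>, and \<open>A\<close> maps the stacked vector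
  to its component \<open>s j\<close>.\<close>

lemma lift_mat_quadratic_form:
  assumes JM: "J \<subseteq> {..<M}" and j: "j \<in> J" and P: "P j \<in> carrier_mat (n j) (n j)"
    and s: "\<And>j. s j \<in> carrier_vec (n j)"
  shows "stack_vec J s \<bullet> (lift_mat n M J P j *\<^sub>v stack_vec J s) = s j \<bullet> (P j *\<^sub>v s j)"
proof -
  let ?N = "total_dim n {..<M}" and ?d = "total_dim n J"
  let ?W = "nbr_sel_mat n M J" and ?U = "sel_mat n M j" and ?y = "stack_vec J s"
  have J: "finite J" using JM finite_subset by blast
  note W = nbr_sel_mat_carrier[OF J, of n M] and U = sel_mat_carrier[of n M j]
  have y: "?y \<in> carrier_vec ?d" using s by (intro stack_vec_carrier[OF J]) auto
  have A: "?U * ?W\<^sup>T \<in> carrier_mat (n j) ?d" using U W by auto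
  have Ay: "(?U * ?W\<^sup>T) *\<^sub>v ?y = s j"
    using sel_mat_nbr_sel_transpose[of J M j s n, OF JM _ s] j JM
      assoc_mult_mat_vec[OF U _ y, of "?W\<^sup>T"] W by auto
  have "lift_mat n M J P j = (?W * ?U\<^sup>T) * P j * (?U * ?W\<^sup>T)"
    unfolding lift_mat_def using U W P
    by (intro assoc_mult_mat[of _ ?d "n j" _ ?N _ ?d]) auto
  also have "?W * ?U\<^sup>T = (?U * ?W\<^sup>T)\<^sup>T"
    using U W by (subst transpose_mult[of _ "n j" ?N _ ?d]) auto
  finally have L: "lift_mat n M J P j = (?U * ?W\<^sup>T)\<^sup>T * P j * (?U * ?W\<^sup>T)" .
  have "lift_mat n M J P j *\<^sub>v ?y = ((?U * ?W\<^sup>T)\<^sup>T * P j) *\<^sub>v ((?U * ?W\<^sup>T) *\<^sub>v ?y)"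
    unfolding L using A P y by (intro assoc_mult_mat_vec[of _ ?d "n j" _ ?d]) auto
  also have "\<dots> = (?U * ?W\<^sup>T)\<^sup>T *\<^sub>v (P j *\<^sub>v s j)"
    unfolding Ay using A P s by (intro assoc_mult_mat_vec[of _ ?d "n j" _ "n j"]) auto
  finally have "?y \<bullet> (lift_mat n M J P j *\<^sub>v ?y) = ((?U * ?W\<^sup>T)\<^sup>T *\<^sub>v (P j *\<^sub>v s j)) \<bullet> ?y"
    using y A P s by (simp add: comm_scalar_prod[of _ ?d])
  also have "\<dots> = (P j *\<^sub>v s j) \<bullet> s j"
    using transpose_vec_mult_scalar[OF A y, of "P j *\<^sub>v s j"] P s Ay by simp
  also have "\<dots> = s j \<bullet> (P j *\<^sub>v s j)"
    using P s by (simp add: comm_scalar_prod[of _ "n j"])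
  finally show ?thesis .
qed

text \<open>The quadratic form is additive in the matrix. The carrier fact travels along in the
  induction because distributing over \<open>A k + ?S\<close> requires the dimensions of the partial
  sum \<open>?S\<close>.\<close>

lemma finsum_mat_quadratic_form:
  fixes A :: "'i \<Rightarrow> real mat"
  assumes "finite I" and "\<And>k. k \<in> I \<Longrightarrow> A k \<in> carrier_mat d d" and v: "v \<in> carrier_vec d"
  shows "finsum (ring_mat TYPE(real) d ()) A I \<in> carrier_mat d d \<and>
    v \<bullet> (finsum (ring_mat TYPE(real) d ()) A I *\<^sub>v v) = (\<Sum>k\<in>I. v \<bullet> (A k *\<^sub>v v))"
proof -
  interpret R: ring "ring_mat TYPE(real) d ()" by (rule ring_mat)
  show ?thesis
    using assms(1,2)
  proof (induction I)
    case empty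
    have "0\<^sub>m d d *\<^sub>v v = 0\<^sub>v d" using v by (intro eq_vecI) auto
    then show ?case using v by (simp add: ring_mat_simps)
  next
    case (insert k I)
    let ?S = "finsum (ring_mat TYPE(real) d ()) A I"
    have eq: "finsum (ring_mat TYPE(real) d ()) A (insert k I) = A k + ?S"
      using insert by (subst R.finsum_insert) (auto simp: ring_mat_simps)
    have Ak: "A k \<in> carrier_mat d d" and S: "?S \<in> carrier_mat d d"
      using insert by auto
    have "v \<bullet> ((A k + ?S) *\<^sub>v v) = v \<bullet> (A k *\<^sub>v v) + v \<bullet> (?S *\<^sub>v v)"
      using add_mult_distrib_mat_vec[OF Ak S v] v Ak S by (simp add: scalar_prod_add_distrib[of _ d])
    then show ?case using insert Ak S by (simp add: eq)
  qed
qed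

text \<open>At the test vector with last entry -1, the corner contributes \<open>e\<close> and each
  off-diagonal block contributes minus \<open>(C *\<^sub>v s) $ 0\<close>. The two contributions
  agree because symmetry forces \<open>B = C\<^sup>T\<close>.\<close>

lemma pos_semidef_bordered:
  fixes A B C :: "real mat"
  assumes psd: "pos_semidef_mat (four_block_mat A B C (mat 1 1 (\<lambda>_. e)))"
    and A: "A \<in> carrier_mat d d" and B: "B \<in> carrier_mat d 1" and C: "C \<in> carrier_mat 1 d"
    and s: "s \<in> carrier_vec d"
  shows "2 * (C *\<^sub>v s) $ 0 \<le> s \<bullet> (A *\<^sub>v s) + e"
proof -
  let ?E = "mat 1 1 (\<lambda>_. e)" and ?w = "vec 1 (\<lambda>_. - 1 :: real)"
  let ?F = "four_block_mat A B C ?E"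
  have sym: "?F\<^sup>T = ?F" using psd by (simp add: pos_semidef_mat_def)
  have BC: "B = C\<^sup>T"
  proof (rule eq_matI)
    fix p q assume "p < dim_row (C\<^sup>T)" "q < dim_col (C\<^sup>T)"
    then have pq: "p < d" "q = 0" using C by auto
    \<comment> \<open>Index \<open>d\<close> is the last column, just after the \<open>d\<close>
      columns of \<open>A\<close>. Transposing moves the entry to the last row, which holds
      \<open>C\<close>.\<close>
    have "B $$ (p, 0) = ?F $$ (p, d)" using pq A B C by simp
    also have "\<dots> = ?F\<^sup>T $$ (p, d)" by (simp only: sym)
    also have "\<dots> = C $$ (0, p)" using pq A B C by simp
    finally show "B $$ (p, q) = C\<^sup>T $$ (p, q)" using pq C by simp
  qed (use B C in auto)
  have CE: "C *\<^sub>v s + ?E *\<^sub>v ?w \<in> carrier_vec 1"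
    using C by (intro carrier_vecI) simp
  have "s @\<^sub>v ?w \<in> carrier_vec (dim_row ?F)"
    using A s by (simp del: One_nat_def)
  then have "0 \<le> (s @\<^sub>v ?w) \<bullet> (?F *\<^sub>v (s @\<^sub>v ?w))"
    using psd unfolding pos_semidef_mat_def by blast
  also have "?F *\<^sub>v (s @\<^sub>v ?w) = (A *\<^sub>v s + B *\<^sub>v ?w) @\<^sub>v (C *\<^sub>v s + ?E *\<^sub>v ?w)"
    using A B C s by (intro four_block_mat_mult_vec) auto
  also have "(s @\<^sub>v ?w) \<bullet> \<dots> = s \<bullet> (A *\<^sub>v s + B *\<^sub>v ?w) + ?w \<bullet> (C *\<^sub>v s + ?E *\<^sub>v ?w)"
    using A B s CE by (intro scalar_prod_append[of _ d _ 1]) auto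
  also have "s \<bullet> (A *\<^sub>v s + B *\<^sub>v ?w) = s \<bullet> (A *\<^sub>v s) + s \<bullet> (B *\<^sub>v ?w)"
    using A B s by (intro scalar_prod_add_distrib) auto
  also have "s \<bullet> (B *\<^sub>v ?w) = ?w \<bullet> (C *\<^sub>v s)"
    using transpose_vec_mult_scalar[OF C s, of ?w] B s
    by (simp add: BC comm_scalar_prod[of s d])
  also have "?w \<bullet> (C *\<^sub>v s) = - (C *\<^sub>v s) $ 0"
    using C by (simp add: scalar_prod_def)
  also have "?w \<bullet> (C *\<^sub>v s + ?E *\<^sub>v ?w) = - (C *\<^sub>v s) $ 0 + e"
    using C by (simp add: scalar_prod_def)
  finally show ?thesis by simp
qed

section \<open>Normalizing an ellipsoid to unit size\<close>

lemma ellipsoid_scaling: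
  assumes P: "P \<in> carrier_mat d d" "pos_def_mat P" and \<alpha>: "0 \<le> \<alpha>"
    and xc: "x \<in> carrier_vec d" "c \<in> carrier_vec d"
    and ell: "(x - c) \<bullet> (P *\<^sub>v (x - c)) \<le> \<alpha>"
  shows "\<exists>s \<in> carrier_vec d. x = sqrt \<alpha> \<cdot>\<^sub>v s + c \<and> s \<bullet> (P *\<^sub>v s) \<le> 1"
proof (cases "\<alpha> = 0")
  case True
  \<comment> \<open>At size zero the quadratic form of \<open>x - c\<close> is at most 0, which
    definiteness excludes for a nonzero vector.\<close>
  have "x - c = 0\<^sub>v d"
    using P ell xc True by (force simp: pos_def_mat_def)
  moreover have "x = (x - c) + c" using xc by auto
  ultimately have "x = 0\<^sub>v d + c" by simp
  then show ?thesis using True xc P(1) by (intro bexI[of _ "0\<^sub>v d"]) auto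
next
  case False
  let ?s = "(1 / sqrt \<alpha>) \<cdot>\<^sub>v (x - c)"
  have pos: "sqrt \<alpha> > 0" using False \<alpha> by simp
  have y: "x - c \<in> carrier_vec d" using xc by simp
  \<comment> \<open>The factor \<open>1 / sqrt \<alpha>\<close> comes out once from each argument of
    the form, giving \<open>1 / \<alpha>\<close> in total.\<close>
  have "?s \<bullet> (P *\<^sub>v ?s) = (1 / sqrt \<alpha>) * ((1 / sqrt \<alpha>) * ((x - c) \<bullet> (P *\<^sub>v (x - c))))"
    using P(1) xc by (simp add: mult_mat_vec[OF P(1) y])
  also have "\<dots> = ((x - c) \<bullet> (P *\<^sub>v (x - c))) / \<alpha>"
    using \<alpha> False by (simp add: field_simps)
  also have "\<dots> \<le> 1" using ell \<alpha> False by simp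
  finally have "?s \<bullet> (P *\<^sub>v ?s) \<le> 1" .
  moreover have "x = sqrt \<alpha> \<cdot>\<^sub>v ?s + c"
    using xc pos by (intro eq_vecI) auto
  ultimately show ?thesis using y by (intro bexI[of _ ?s]) auto
qed

section \<open>The input constraint over all neighboring ellipsoids\<close>

theorem proposition7:
  fixes M :: nat
    and n m r :: "nat \<Rightarrow> nat"
    and \<N> :: "nat \<Rightarrow> nat set"
    and P K H :: "nat \<Rightarrow> real mat"
    and h c :: "nat \<Rightarrow> real vec"
    and \<alpha> :: "nat \<Rightarrow> real"
    and i l :: nat
  assumes neighbors: "\<forall>k<M. \<N> k \<subseteq> {..<M} \<and> k \<in> \<N> k"
    and P: "\<forall>j<M. P j \<in> carrier_mat (n j) (n j) \<and> pos_def_mat (P j)"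
    and K: "\<forall>k<M. K k \<in> carrier_mat (m k) (total_dim n (\<N> k))"
    and H: "\<forall>k<M. H k \<in> carrier_mat (r k) (m k)"
    and h: "\<forall>k<M. h k \<in> carrier_vec (r k)"
    and origin: "\<forall>k<M. origin_in_interior (m k) (input_set (H k) (h k))"
    and i: "i < M"
    and l: "l < r i"
    and c: "\<forall>j<M. c j \<in> carrier_vec (n j)"
    and \<alpha>: "\<forall>j<M. 0 \<le> \<alpha> j"
    and lmi: "\<exists>\<beta> :: nat \<Rightarrow> real. (\<forall>j\<in>\<N> i. 0 \<le> \<beta> j) \<and>
      pos_semidef_mat (input_lmi_mat n M (\<N> i) P (K i) (row (H i) l) (h i $ l) c \<alpha> \<beta>)"
  shows "\<forall>x :: nat \<Rightarrow> real vec.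
    (\<forall>j\<in>\<N> i. x j \<in> carrier_vec (n j) \<and> (x j - c j) \<bullet> (P j *\<^sub>v (x j - c j)) \<le> \<alpha> j) \<longrightarrow>
    row (H i) l \<bullet> (K i *\<^sub>v stack_vec (\<N> i) x) \<le> h i $ l"
proof (intro allI impI)
  fix x :: "nat \<Rightarrow> real vec"
  let ?J = "\<N> i" and ?Hl = "row (H i) l" and ?hl = "h i $ l"
  let ?d = "total_dim n ?J" and ?R = "nbr_size_sqrt n M ?J \<alpha>"
  assume x: "\<forall>j\<in>?J. x j \<in> carrier_vec (n j) \<and> (x j - c j) \<bullet> (P j *\<^sub>v (x j - c j)) \<le> \<alpha> j"
  from lmi obtain \<beta> where \<beta>: "\<forall>j\<in>?J. 0 \<le> \<beta> j"
    and psd: "pos_semidef_mat (input_lmi_mat n M ?J P (K i) ?Hl ?hl c \<alpha> \<beta>)" by blast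
  have JM: "?J \<subseteq> {..<M}" using neighbors i by blast
  then have J: "finite ?J" using finite_subset by blast
  have Ki: "K i \<in> carrier_mat (m i) ?d" using K i by blast
  have Hl: "?Hl \<in> carrier_vec (m i)" using H i l by auto
  have "\<exists>s \<in> carrier_vec (n j). x j = sqrt (\<alpha> j) \<cdot>\<^sub>v s + c j \<and> s \<bullet> (P j *\<^sub>v s) \<le> 1"
    if "j \<in> ?J" for j
    using that x P c \<alpha> JM by (intro ellipsoid_scaling) auto
  \<comment> \<open>Outside the neighbor set the zero vector serves as a default, so that
    \<open>s\<close> has the right dimension at every index, as the selection lemmas
    require.\<close>
  then have "\<forall>j. \<exists>s. s \<in> carrier_vec (n j) \<and>
      (j \<in> ?J \<longrightarrow> x j = sqrt (\<alpha> j) \<cdot>\<^sub>v s + c j \<and> s \<bullet> (P j *\<^sub>v s) \<le> 1)"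
    by (metis zero_carrier_vec)
  then obtain s where s: "\<And>j. s j \<in> carrier_vec (n j)"
    and xs: "\<And>j. j \<in> ?J \<Longrightarrow> x j = sqrt (\<alpha> j) \<cdot>\<^sub>v s j + c j"
    and ball: "\<And>j. j \<in> ?J \<Longrightarrow> s j \<bullet> (P j *\<^sub>v s j) \<le> 1"
    by metis
  let ?s = "stack_vec ?J s" and ?c = "nbr_center n M ?J c"
  let ?Q = "\<Oplus>\<^bsub>ring_mat TYPE(real) ?d ()\<^esub>j\<in>?J. \<beta> j \<cdot>\<^sub>m lift_mat n M ?J P j"
  have sd: "?s \<in> carrier_vec ?d" using s by (intro stack_vec_carrier[OF J]) auto
  have R: "?R \<in> carrier_mat ?d ?d"
    using nbr_size_mat_carrier[OF J] by (simp add: nbr_size_sqrt_eq[OF JM])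
  have cJ: "?c = stack_vec ?J c"
    unfolding nbr_center_def using c JM by (intro nbr_sel_mat_stack_vec)
  have cd: "?c \<in> carrier_vec ?d"
    unfolding cJ using c JM by (intro stack_vec_carrier[OF J]) auto
  have "stack_vec ?J x = stack_vec ?J (\<lambda>j. sqrt (\<alpha> j) \<cdot>\<^sub>v s j + c j)"
    using xs by (intro stack_vec_cong[OF J])
  also have "\<dots> = ?R *\<^sub>v ?s + ?c"
    unfolding cJ nbr_size_sqrt_eq[OF JM] nbr_size_mat_stack_vec[of ?J M s n, OF JM s]
    using s c JM by (intro stack_vec_add[OF J]) auto
  finally have x_eq: "stack_vec ?J x = ?R *\<^sub>v ?s + ?c" .
  have lift: "\<beta> j \<cdot>\<^sub>m lift_mat n M ?J P j \<in> carrier_mat ?d ?d" for j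
    using lift_mat_carrier[OF J, of n M P j] by simp
  have Q: "?Q \<in> carrier_mat ?d ?d"
    and "?s \<bullet> (?Q *\<^sub>v ?s) = (\<Sum>j\<in>?J. ?s \<bullet> ((\<beta> j \<cdot>\<^sub>m lift_mat n M ?J P j) *\<^sub>v ?s))"
    using finsum_mat_quadratic_form[of ?J "\<lambda>j. \<beta> j \<cdot>\<^sub>m lift_mat n M ?J P j", OF J lift sd]
    by simp_all
  note this(2)
  also have "\<dots> = (\<Sum>j\<in>?J. \<beta> j * (s j \<bullet> (P j *\<^sub>v s j)))"
  proof (rule sum.cong)
    fix j assume j: "j \<in> ?J"
    note L = lift_mat_carrier[OF J, of n M P j]
    have "(\<beta> j \<cdot>\<^sub>m lift_mat n M ?J P j) *\<^sub>v ?s = \<beta> j \<cdot>\<^sub>v (lift_mat n M ?J P j *\<^sub>v ?s)"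
      by (rule smult_mat_mult_vec[OF L sd])
    moreover have "?s \<bullet> (lift_mat n M ?J P j *\<^sub>v ?s) = s j \<bullet> (P j *\<^sub>v s j)"
      using lift_mat_quadratic_form[of ?J M j P n s] JM j P s by auto
    ultimately show "?s \<bullet> ((\<beta> j \<cdot>\<^sub>m lift_mat n M ?J P j) *\<^sub>v ?s) = \<beta> j * (s j \<bullet> (P j *\<^sub>v s j))"
      using L sd by simp
  qed simp
  \<comment> \<open>Each normalized form is at most 1 and each multiplier is nonnegative.\<close>
  also have "\<dots> \<le> (\<Sum>j\<in>?J. \<beta> j)"
    using \<beta> ball by (intro sum_mono) (simp add: mult_left_le)
  finally have Q_le: "?s \<bullet> (?Q *\<^sub>v ?s) \<le> (\<Sum>j\<in>?J. \<beta> j)" .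
  let ?C = "(1/2) \<cdot>\<^sub>m (mat_of_row ?Hl * K i * ?R)"
  have HK: "mat_of_row ?Hl * K i \<in> carrier_mat 1 ?d"
    using Hl Ki by (intro mult_carrier_mat[of _ 1 "m i"]) auto
  have C: "?C \<in> carrier_mat 1 ?d" using HK R by simp
  have "?C *\<^sub>v ?s = (1/2) \<cdot>\<^sub>v ((mat_of_row ?Hl * K i * ?R) *\<^sub>v ?s)"
    using HK R sd by (intro smult_mat_mult_vec[of _ 1 ?d]) auto
  also have "(mat_of_row ?Hl * K i * ?R) *\<^sub>v ?s = (mat_of_row ?Hl * K i) *\<^sub>v (?R *\<^sub>v ?s)"
    using HK R sd by (intro assoc_mult_mat_vec)
  also have "\<dots> = mat_of_row ?Hl *\<^sub>v (K i *\<^sub>v (?R *\<^sub>v ?s))"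
    using Hl Ki R sd by (intro assoc_mult_mat_vec[of _ 1 "m i"]) auto
  \<comment> \<open>The factor 1/2 of the off-diagonal block cancels the 2 coming from the two equal
    cross terms.\<close>
  finally have Cs: "2 * (?C *\<^sub>v ?s) $ 0 = ?Hl \<bullet> (K i *\<^sub>v (?R *\<^sub>v ?s))" by simp
  have "2 * (?C *\<^sub>v ?s) $ 0 \<le>
      ?s \<bullet> (?Q *\<^sub>v ?s) + (?hl - ?Hl \<bullet> (K i *\<^sub>v ?c) - (\<Sum>j\<in>?J. \<beta> j))"
    using R Ki Hl by (intro pos_semidef_bordered[OF psd[unfolded input_lmi_mat_def] Q _ C sd]) auto
  \<comment> \<open>The bound \<open>Q_le\<close> on the quadratic form is absorbed by the sum of
    multipliers subtracted in the corner entry. What remains is the constraint, split along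
    \<open>x_eq\<close> into its scaled part and its center part.\<close>
  then have "?Hl \<bullet> (K i *\<^sub>v (?R *\<^sub>v ?s)) + ?Hl \<bullet> (K i *\<^sub>v ?c) \<le> ?hl"
    using Cs Q_le by linarith
  moreover have "?Hl \<bullet> (K i *\<^sub>v stack_vec ?J x) =
      ?Hl \<bullet> (K i *\<^sub>v (?R *\<^sub>v ?s)) + ?Hl \<bullet> (K i *\<^sub>v ?c)"
    unfolding x_eq using mult_add_distrib_mat_vec[OF Ki _ cd, of "?R *\<^sub>v ?s"] R sd cd Ki Hl
    by (simp add: scalar_prod_add_distrib[of _ "m i"])
  ultimately show "?Hl \<bullet> (K i *\<^sub>v stack_vec ?J x) \<le> ?hl" by simp
qed

end
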